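(* Let $\lambda>0$ and $0<\alpha\le1$. For every integer $r\ge1$ and every $t>0$, the $r$th factorial moment $\hat\psi_\alpha(r,t)=\mathbb E\big(\hat N_\alpha(t)(\hat N_\alpha(t)-1)\cdots(\hat N_\alpha(t)-r+1)\big)$ is given by $$\hat\psi_\alpha(r,t)=r!\,\lambda^{2r}t^{2\alpha r}E^{r}_{\alpha,2\alpha r+1}(-2\lambda t^\alpha).$$
   Context: Three-parameter Mittag-Leffler function: $E_{\alpha,\beta}^{\gamma}(x)=\frac{1}{\Gamma(\gamma)}\sum_{j=0}^\infty\frac{\Gamma(j+\gamma)x^j}{j!\,\Gamma(j\alpha+\beta)}$ for $\alpha,\beta,\gamma>0$, $x\in\mathbb R$. For $\lambda>0$ and $0<\alpha\le1$, $\{\hat N_\alpha(t)\}_{t\ge0}$ is the renewal counting process with $\hat N_\alpha(0)=0$ whose i.i.d. interarrival times have density $\lambda^2t^{2\alpha-1}E^2_{\alpha,2\alpha}(-\lambda t^\alpha)$, $t>0$. Its probability mass function is, for $n\ge0$, $$\Pr\{\hat N_\alpha(t)=n\}=\lambda^{2n}t^{2n\alpha}E_{\alpha,2n\alpha+1}^{2n+1}(-\lambda t^\alpha)+\lambda^{2n+1}t^{(2n+1)\alpha}E_{\alpha,(2n+1)\alpha+1}^{2n+2}(-\lambda t^\alpha).$$ *)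

theory Defs
  imports "HOL-Probability.Probability"
begin

definition mittag_leffler3 :: "real \<Rightarrow> real \<Rightarrow> real \<Rightarrow> real \<Rightarrow> real" where
  "mittag_leffler3 \<alpha> \<beta> \<gamma> x =
     (1 / Gamma \<gamma>) * (\<Sum>j. Gamma (real j + \<gamma>) * x ^ j / (fact j * Gamma (real j * \<alpha> + \<beta>)))"

definition interarrival_density :: "real \<Rightarrow> real \<Rightarrow> real \<Rightarrow> real" where
  "interarrival_density \<alpha> lam t =
     (if t > 0 then lam\<^sup>2 * t powr (2 * \<alpha> - 1) * mittag_leffler3 \<alpha> (2 * \<alpha>) 2 (- lam * t powr \<alpha>) else 0)"

text \<open>
  The number of renewal epochs \<open>T 0 + ... + T (n - 1)\<close>, \<open>n \<ge> 1\<close>, in \<open>[0,t]\<close>, where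
  \<open>T 0, T 1, ...\<close> are the interarrival times. For i.i.d. times with a density supported on the
  positive half-line the set below is almost surely finite, so the convention that an infinite
  set has cardinality 0 matters only on a null set.
\<close>
definition renewal_count :: "(nat \<Rightarrow> 'a \<Rightarrow> real) \<Rightarrow> real \<Rightarrow> 'a \<Rightarrow> nat" where
  "renewal_count T t \<omega> = card {n. n \<ge> 1 \<and> (\<Sum>i<n. T i \<omega>) \<le> t}"

text \<open>
  The product is taken over the reals; it vanishes when the count is less than \<open>r\<close>.
\<close>
definition falling_factorial :: "nat \<Rightarrow> nat \<Rightarrow> real" where
  "falling_factorial n r = (\<Prod>k<r. real n - real k)"

definition factorial_moment :: "'a measure \<Rightarrow> ('a \<Rightarrow> nat) \<Rightarrow> nat \<Rightarrow> real" where
  "factorial_moment M N r = prob_space.expectation M (\<lambda>\<omega>. falling_factorial (N \<omega>) r)"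

end

theory Submission
  imports Defs
begin

text \<open>
  Write \<open>q\<^sub>a(s) = s\<^bsup>a-1\<^esup>/\<Gamma>(a)\<close> for \<open>s > 0\<close>. Since \<open>q\<^sub>a * q\<^sub>b = q\<^bsub>a+b\<^esub>\<close> under convolution on the half-line
  (this is the Beta integral), sending the variable \<open>X\<close> to \<open>q\<^sub>\<alpha>\<close> turns every power series \<open>A\<close> without
  constant term and with positive radius of convergence into a series \<open>\<Sum> A\<^sub>m q\<^bsub>\<alpha>m\<^esub>\<close> that converges
  everywhere, and turns products of power series into convolutions (\<open>rl_series_convolution\<close>). More generally \<open>\<Sum> A\<^sub>m q\<^bsub>\<alpha>m+\<beta>\<^esub>\<close> corresponds
  to an extra factor \<open>q\<^sub>\<beta>\<close>, and \<open>\<beta> = 1\<close> means integration from 0. In this calculus the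
  three-parameter Mittag-Leffler functions are the images of the series \<open>X\<^sup>p (1 - cX)\<^bsup>-k\<^esup>\<close>
  (\<open>rl_series_mittag_leffler3\<close>), and the probabilistic statement becomes an identity between
  rational functions.

  Let \<open>G = \<lambda>X/(1 + \<lambda>X)\<close>. The interarrival density is the image of \<open>G\<^sup>2\<close>, so the \<open>n\<close>-th renewal epoch
  \<open>S\<^sub>n\<close> has as density the image of \<open>G\<^bsup>2n\<^esup>\<close> (\<open>partial_sum_distributed\<close>), and \<open>P(S\<^sub>n \<le> t)\<close> is the
  same series with \<open>\<beta> = 1\<close> (\<open>prob_le_rl_series\<close>). If \<open>N\<close> epochs fall into \<open>[0,t]\<close>, then
  \<open>(N choose r) = \<Sum>\<^bsub>n<N\<^esub> (n choose (r - 1))\<close>, so the \<open>r\<close>-th factorial moment is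
  \<open>r! \<Sum>\<^sub>n (n choose (r - 1)) P(S\<^bsub>n+1\<^esub> \<le> t)\<close>. On the side of power series
  \<open>\<Sum>\<^sub>n (n choose (r - 1)) Y\<^bsup>n+1\<^esup> = (Y/(1 - Y))\<^sup>r\<close>, and for \<open>Y = G\<^sup>2\<close> the fraction collapses:
  \<open>G\<^sup>2/(1 - G\<^sup>2) = \<lambda>\<^sup>2X\<^sup>2/((1 + \<lambda>X)\<^sup>2 - \<lambda>\<^sup>2X\<^sup>2) = \<lambda>\<^sup>2X\<^sup>2/(1 + 2\<lambda>X)\<close>. This is where the argument
  \<open>-2\<lambda>t\<^sup>\<alpha>\<close> comes from. The infinite sum over \<open>n\<close> may be exchanged with the series by dominated
  convergence, because replacing \<open>\<lambda>\<close> by \<open>-\<lambda>\<close> makes all coefficients of \<open>G\<^bsup>2n\<^esup>\<close> nonnegative without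
  changing their absolute values (\<open>binomial_sum_rl_series\<close>).

  One analytic fact is needed. A law with density \<open>ennreal \<circ> f\<close> sees only the positive part of \<open>f\<close>,
  so computing with the signed series for \<open>f\<close> requires \<open>f \<ge> 0\<close>. As \<open>f\<close> is the convolution square of the
  image \<open>g\<close> of \<open>G\<close>, it is enough that \<open>g > 0\<close>. The identity \<open>G = \<lambda>X - \<lambda>X G\<close> says that \<open>g\<close> is the
  Volterra resolvent of the kernel \<open>\<lambda>q\<^sub>\<alpha>\<close>, which is log-convex for \<open>\<alpha> \<le> 1\<close>, and such a resolvent is
  positive (\<open>volterra_resolvent_pos\<close>).
\<close>

unbundle no vec_syntax
unbundle fps_syntax

section \<open>Riemann-Liouville kernels\<close>

text \<open>
  The convolution kernel of the fractional integral of order \<open>a\<close>. Because of the convention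
  \<open>Gamma 0 = 0\<close>, the kernel of order 0 is the zero function and not the unit of convolution; the side
  conditions on constant coefficients further below come from this.
\<close>
definition rl_kernel :: "real \<Rightarrow> real \<Rightarrow> real" where
  "rl_kernel a s = (if s > 0 then s powr (a - 1) / Gamma a else 0)"

lemma rl_kernel_nonneg: "a \<ge> 0 \<Longrightarrow> rl_kernel a s \<ge> 0"
  by (cases "a = 0") (auto simp: rl_kernel_def intro!: divide_nonneg_nonneg less_imp_le[OF Gamma_real_pos])

lemma rl_kernel_measurable [measurable]: "rl_kernel a \<in> borel_measurable borel"
  unfolding rl_kernel_def[abs_def] by measurable

lemma rl_kernel_1: "rl_kernel 1 s = (if s > 0 then 1 else 0)"
  by (simp add: rl_kernel_def)

lemma rl_kernel_scale: "t > 0 \<Longrightarrow> rl_kernel a (t * u) = t powr (a - 1) * rl_kernel a u"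
  by (auto simp: rl_kernel_def powr_mult zero_less_mult_iff)

text \<open>
  The semigroup law of fractional integration: after scaling \<open>[0,t]\<close> to \<open>[0,1]\<close> it is the Beta integral.
\<close>
lemma rl_kernel_convolution:
  assumes "a > 0" "b > 0"
  shows "has_bochner_integral lborel (\<lambda>s. rl_kernel a (t - s) * rl_kernel b s) (rl_kernel (a + b) t)"
proof (cases "t > 0")
  case False
  have "(\<lambda>s. rl_kernel a (t - s) * rl_kernel b s) = (\<lambda>_. 0)"
    using False by (auto simp: rl_kernel_def fun_eq_iff)
  moreover have "rl_kernel (a + b) t = 0"
    using False by (simp add: rl_kernel_def)
  ultimately show ?thesis by (simp add: has_bochner_integral_zero)
next
  case t: True
  let ?h = "\<lambda>u. rl_kernel a (1 - u) * rl_kernel b u"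
  define B where "B = Beta b a / (Gamma a * Gamma b)"
  have B: "B = 1 / Gamma (a + b)"
    using Gamma_real_pos[OF assms(1)] Gamma_real_pos[OF assms(2)] assms
    by (simp del: Gamma_real_pos add: B_def Beta_def add.commute)
  have "((\<lambda>u. u powr (b - 1) * (1 - u) powr (a - 1) / (Gamma a * Gamma b)) has_integral B) {0..1}"
    unfolding B_def by (intro has_integral_divide has_integral_Beta_real assms)
  hence "(?h has_integral B) {0..1}"
    by (rule has_integral_eq[rotated]) (auto simp: rl_kernel_def)
  hence "((\<lambda>u. if u \<in> {0..1} then ?h u else 0) has_integral B) UNIV"
    by (simp only: has_integral_restrict_UNIV)
  also have "(\<lambda>u. if u \<in> {0..1} then ?h u else 0) = ?h"
    by (auto simp: rl_kernel_def fun_eq_iff)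
  finally have "(\<integral>\<^sup>+u. ennreal (?h u) \<partial>lborel) = ennreal B"
    using assms by (intro nn_integral_has_integral_lborel) (auto intro!: mult_nonneg_nonneg rl_kernel_nonneg)
  hence *: "has_bochner_integral lborel ?h B"
    using assms Gamma_real_pos[of "a + b"]
    by (intro has_bochner_integral_nn_integral) (auto intro!: mult_nonneg_nonneg rl_kernel_nonneg simp: B)
  have "has_bochner_integral lborel (\<lambda>u. t powr (a + b - 2) * ?h u) (t powr (a + b - 2) * B)"
    by (intro has_bochner_integral_mult_right *)
  also have "(\<lambda>u. t powr (a + b - 2) * ?h u) = (\<lambda>u. rl_kernel a (t - (0 + t * u)) * rl_kernel b (0 + t * u))"
  proof
    fix u
    have "rl_kernel a (t - (0 + t * u)) = rl_kernel a (t * (1 - u))"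
      by (simp add: algebra_simps)
    moreover have "t powr (a + b - 2) = t powr (a - 1) * t powr (b - 1)"
      using t by (simp flip: powr_add add: algebra_simps)
    ultimately show "t powr (a + b - 2) * ?h u = rl_kernel a (t - (0 + t * u)) * rl_kernel b (0 + t * u)"
      using t by (simp add: rl_kernel_scale)
  qed
  also have "t powr (a + b - 2) * B = rl_kernel (a + b) t /\<^sub>R \<bar>t\<bar>"
    using t by (simp add: rl_kernel_def B powr_diff field_simps power2_eq_square)
  finally show ?thesis
    using t by (subst lborel_has_bochner_integral_real_affine_iff[where c = t and t = 0]) auto
qed

text \<open>
  Keep only the part \<open>[K, \<infinity>)\<close> of the Gamma integral. As \<open>K\<close> is free, this shows that \<open>Gamma\<close> grows
  faster than every exponential, without appeal to Stirling's formula.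
\<close>
lemma Gamma_lower_bound:
  assumes "x \<ge> 1" "K > 0"
  shows "K powr (x - 1) * exp (- K) \<le> Gamma (x :: real)"
proof -
  have "((\<lambda>u. exp (- 1 * u)) has_integral exp (- 1 * K) / 1) {K..}"
    by (rule has_integral_exp_minus_to_infinity) simp
  hence "((\<lambda>u. K powr (x - 1) * exp (- u)) has_integral K powr (x - 1) * exp (- K)) {K..}"
    by (intro has_integral_mult_right) simp
  hence "((\<lambda>u. if u \<in> {K..} then K powr (x - 1) * exp (- u) else 0) has_integral K powr (x - 1) * exp (- K)) {0..}"
    using assms by (subst has_integral_restrict) auto
  moreover have "((\<lambda>u. u powr (x - 1) / exp u) has_integral Gamma x) {0..}"
    using assms by (intro Gamma_integral_real) simp
  ultimately show ?thesis
  proof (rule has_integral_le)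
    fix u :: real assume "u \<in> {0..}"
    show "(if u \<in> {K..} then K powr (x - 1) * exp (- u) else 0) \<le> u powr (x - 1) / exp u"
      using assms by (auto simp: exp_minus field_simps intro!: powr_mono2)
  qed
qed

text \<open>
  The ratio \<open>\<rho>\<close> is arbitrary, so a series \<open>\<Sum> a\<^sub>m q\<^bsub>\<alpha>m+\<beta>\<^esub>(t)\<close> converges as soon as the \<open>a\<^sub>m\<close> grow at most
  geometrically.
\<close>
lemma rl_kernel_geometric_bound:
  assumes "\<alpha> > 0" "\<rho> > 0"
  obtains C where "C \<ge> 0" "\<And>m. \<alpha> * real m + \<beta> \<ge> 1 \<Longrightarrow> rl_kernel (\<alpha> * real m + \<beta>) t \<le> C * \<rho> ^ m"
proof (cases "t > 0")
  case False
  thus ?thesis by (intro that[of 0]) (auto simp: rl_kernel_def)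
next
  case t: True
  \<comment> \<open>This \<open>K\<close> makes \<open>(t / K) powr \<alpha>\<close> equal to \<open>\<rho>\<close>.\<close>
  define K where "K = t * \<rho> powr (- 1 / \<alpha>)"
  have K: "K > 0" using t assms by (simp add: K_def)
  have tK: "t / K = \<rho> powr (1 / \<alpha>)"
    using t assms by (simp add: K_def powr_minus field_simps)
  show ?thesis
  proof (rule that[of "exp K * (t / K) powr (\<beta> - 1)"])
    fix m assume m: "\<alpha> * real m + \<beta> \<ge> 1"
    let ?x = "\<alpha> * real m + \<beta>"
    have "rl_kernel ?x t = t powr (?x - 1) / Gamma ?x"
      using t by (simp add: rl_kernel_def)
    also have "\<dots> \<le> t powr (?x - 1) / (K powr (?x - 1) * exp (- K))"
      using m K t by (intro divide_left_mono Gamma_lower_bound mult_pos_pos Gamma_real_pos) auto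
    also have "\<dots> = exp K * (t / K) powr (?x - 1)"
      using t K by (simp add: powr_divide exp_minus field_simps)
    also have "(t / K) powr (?x - 1) = (t / K) powr (\<beta> - 1) * (t / K) powr (\<alpha> * real m)"
      by (simp flip: powr_add add: algebra_simps)
    also have "(t / K) powr (\<alpha> * real m) = \<rho> ^ m"
      using assms by (simp add: tK powr_powr powr_realpow)
    finally show "rl_kernel ?x t \<le> exp K * (t / K) powr (\<beta> - 1) * \<rho> ^ m"
      by simp
  qed auto
qed

section \<open>Power series evaluated in convolution powers of a kernel\<close>

lemma fps_conv_radius_mult_pos:
  fixes A B :: "real fps"
  assumes "fps_conv_radius A > 0" "fps_conv_radius B > 0"
  shows "fps_conv_radius (A * B) > 0"
  using assms by (intro less_le_trans[OF _ fps_conv_radius_mult]) auto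

lemma fps_conv_radius_power_pos:
  fixes A :: "real fps"
  shows "fps_conv_radius A > 0 \<Longrightarrow> fps_conv_radius (A ^ n) > 0"
  by (intro less_le_trans[OF _ fps_conv_radius_power])

text \<open>
  The substitution of \<open>q\<^sub>\<alpha>\<close> for \<open>X\<close> in \<open>A\<close>, convolved with \<open>q\<^sub>\<beta>\<close>.
\<close>
definition rl_series :: "real \<Rightarrow> real \<Rightarrow> real fps \<Rightarrow> real \<Rightarrow> real" where
  "rl_series \<alpha> \<beta> A t = (\<Sum>m. A $ m * rl_kernel (\<alpha> * real m + \<beta>) t)"

lemma summable_abs_rl_series:
  assumes "fps_conv_radius A > 0" "\<alpha> > 0"
  shows "summable (\<lambda>m. \<bar>A $ m\<bar> * \<bar>rl_kernel (\<alpha> * real m + \<beta>) t\<bar>)"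
proof -
  obtain \<rho> where \<rho>: "0 < \<rho>" "ereal \<rho> < fps_conv_radius A"
    using ereal_dense2[OF assms(1)] by auto
  hence *: "summable (\<lambda>m. norm (A $ m * \<rho> ^ m))"
    by (intro norm_summable_fps) simp
  obtain C where C: "C \<ge> 0" "\<And>m. \<alpha> * real m + \<beta> \<ge> 1 \<Longrightarrow> rl_kernel (\<alpha> * real m + \<beta>) t \<le> C * \<rho> ^ m"
    by (rule rl_kernel_geometric_bound[OF assms(2) \<rho>(1), of \<beta> t]) blast
  have **: "summable (\<lambda>m. C * norm (A $ m * \<rho> ^ m))"
    by (intro summable_mult *)
  show ?thesis
  proof (rule summable_comparison_test'[OF **])
    fix m assume "m \<ge> nat \<lceil>(1 - \<beta>) / \<alpha>\<rceil>"
    hence "(1 - \<beta>) / \<alpha> \<le> real m" by linarith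
    hence m: "\<alpha> * real m + \<beta> \<ge> 1" using assms by (simp add: field_simps)
    have "\<bar>A $ m\<bar> * \<bar>rl_kernel (\<alpha> * real m + \<beta>) t\<bar> \<le> \<bar>A $ m\<bar> * (C * \<rho> ^ m)"
      using C(2)[OF m] rl_kernel_nonneg[of "\<alpha> * real m + \<beta>" t] m by (intro mult_left_mono) auto
    also have "\<dots> = C * norm (A $ m * \<rho> ^ m)"
      using \<rho> C by (simp add: abs_mult)
    finally show "norm (\<bar>A $ m\<bar> * \<bar>rl_kernel (\<alpha> * real m + \<beta>) t\<bar>) \<le> C * norm (A $ m * \<rho> ^ m)"
      by simp
  qed
qed

lemma summable_rl_series:
  assumes "fps_conv_radius A > 0" "\<alpha> > 0"
  shows "summable (\<lambda>m. A $ m * rl_kernel (\<alpha> * real m + \<beta>) t)"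
  using summable_abs_rl_series[OF assms, of \<beta> t]
  by - (rule summable_rabs_cancel, simp add: abs_mult)

lemma rl_series_eq_0: "t \<le> 0 \<Longrightarrow> rl_series \<alpha> \<beta> A t = 0"
  by (simp add: rl_series_def rl_kernel_def)

text \<open>
  Multiplicativity holds for single kernels by the semigroup law and extends to series by the Cauchy
  product. Integration term by term is justified by the same computation for the series with
  coefficients \<open>\<bar>A $ m\<bar>\<close> and \<open>\<bar>B $ m\<bar>\<close>, whose radii of convergence are the same. A constant term with
  \<open>\<beta> = 0\<close> has to be excluded: it stands for a multiple of the convolution unit, but \<open>rl_series\<close> drops it.
\<close>
lemma rl_series_convolution:
  assumes A: "fps_conv_radius A > 0" and B: "fps_conv_radius B > 0" and \<alpha>: "\<alpha> > 0"
    and \<beta>: "\<beta> \<ge> 0" "\<beta> > 0 \<or> A $ 0 = 0" and \<gamma>: "\<gamma> \<ge> 0" "\<gamma> > 0 \<or> B $ 0 = 0"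
  shows "has_bochner_integral lborel (\<lambda>s. rl_series \<alpha> \<beta> A (t - s) * rl_series \<alpha> \<gamma> B s)
           (rl_series \<alpha> (\<beta> + \<gamma>) (A * B) t)"
proof -
  define a where "a m s = A $ m * rl_kernel (\<alpha> * real m + \<beta>) s" for m s
  define b where "b m s = B $ m * rl_kernel (\<alpha> * real m + \<gamma>) s" for m s
  define c where "c m s = (\<Sum>i\<le>m. a i (t - s) * b (m - i) s)" for m s
  have kernel_conv: "has_bochner_integral lborel (\<lambda>s. rl_kernel (\<alpha> * real i + \<beta>) (t - s) * rl_kernel (\<alpha> * real j + \<gamma>) s)
                  (rl_kernel (\<alpha> * real (i + j) + (\<beta> + \<gamma>)) t)"
    if "A $ i * B $ j \<noteq> 0" for i j
  proof -
    have "\<alpha> * real i + \<beta> > 0"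
      using that \<alpha> \<beta> by (cases "i = 0") (auto intro!: add_pos_nonneg)
    moreover have "\<alpha> * real j + \<gamma> > 0"
      using that \<alpha> \<gamma> by (cases "j = 0") (auto intro!: add_pos_nonneg)
    ultimately show ?thesis
      using rl_kernel_convolution[of "\<alpha> * real i + \<beta>" "\<alpha> * real j + \<gamma>" t]
      by (simp add: algebra_simps)
  qed
  have ab: "has_bochner_integral lborel (\<lambda>s. a i (t - s) * b j s)
              (A $ i * B $ j * rl_kernel (\<alpha> * real (i + j) + (\<beta> + \<gamma>)) t)" for i j
  proof (cases "A $ i * B $ j = 0")
    case True
    hence "(\<lambda>s. a i (t - s) * b j s) = (\<lambda>_. 0)" by (auto simp: a_def b_def)
    thus ?thesis by (simp only: True abs_zero mult_zero_left has_bochner_integral_zero)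
  next
    case False
    from has_bochner_integral_mult_right[OF kernel_conv[OF False], of "A $ i * B $ j"]
    show ?thesis by (simp add: a_def b_def mult_ac)
  qed
  have nab: "has_bochner_integral lborel (\<lambda>s. \<bar>a i (t - s) * b j s\<bar>)
              (\<bar>A $ i * B $ j\<bar> * rl_kernel (\<alpha> * real (i + j) + (\<beta> + \<gamma>)) t)" for i j
  proof (cases "A $ i * B $ j = 0")
    case True
    hence "(\<lambda>s. \<bar>a i (t - s) * b j s\<bar>) = (\<lambda>_. 0)" by (auto simp: a_def b_def)
    thus ?thesis by (simp only: True abs_zero mult_zero_left has_bochner_integral_zero)
  next
    case False
    have "\<bar>a i (t - s) * b j s\<bar> = \<bar>A $ i * B $ j\<bar> * (rl_kernel (\<alpha> * real i + \<beta>) (t - s) * rl_kernel (\<alpha> * real j + \<gamma>) s)" for s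
      using \<alpha> \<beta> \<gamma> by (simp add: a_def b_def abs_mult rl_kernel_nonneg mult_ac)
    with has_bochner_integral_mult_right[OF kernel_conv[OF False], of "\<bar>A $ i * B $ j\<bar>"]
    show ?thesis by simp
  qed
  have c: "has_bochner_integral lborel (c m) ((A * B) $ m * rl_kernel (\<alpha> * real m + (\<beta> + \<gamma>)) t)" for m
  proof -
    have "has_bochner_integral lborel (c m)
            (\<Sum>i\<le>m. A $ i * B $ (m - i) * rl_kernel (\<alpha> * real (i + (m - i)) + (\<beta> + \<gamma>)) t)"
      unfolding c_def[abs_def] by (intro has_bochner_integral_sum ab)
    also have "\<dots> = (A * B) $ m * rl_kernel (\<alpha> * real m + (\<beta> + \<gamma>)) t"
      by (simp add: fps_mult_nth sum_distrib_right atLeast0AtMost)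
    finally show ?thesis .
  qed
  have int_c: "integrable lborel (c m)" for m
    using c by (simp add: has_bochner_integral_iff)
  have sa: "summable (\<lambda>k. norm (a k s))" and sb: "summable (\<lambda>k. norm (b k s))" for s
    using summable_abs_rl_series[OF A \<alpha>, of \<beta> s] summable_abs_rl_series[OF B \<alpha>, of \<gamma> s]
    by (simp_all add: a_def b_def abs_mult)
  have sums: "(\<lambda>m. c m s) sums (rl_series \<alpha> \<beta> A (t - s) * rl_series \<alpha> \<gamma> B s)" for s
    using Cauchy_product_sums[OF sa[of "t - s"] sb[of s]]
    by (simp add: c_def rl_series_def a_def b_def)
  have sc: "summable (\<lambda>m. norm (c m s))" for s
  proof (rule summable_comparison_test')
    show "summable (\<lambda>m. \<Sum>i\<le>m. norm (a i (t - s)) * norm (b (m - i) s))"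
      by (rule summable_Cauchy_product) (use sa[of "t - s"] sb[of s] in simp_all)
    show "norm (norm (c m s)) \<le> (\<Sum>i\<le>m. norm (a i (t - s)) * norm (b (m - i) s))" for m
      unfolding c_def using sum_abs[of "\<lambda>i. a i (t - s) * b (m - i) s" "{..m}"] by (simp add: abs_mult)
  qed
  let ?A = "Abs_fps (\<lambda>n. norm (A $ n))" and ?B = "Abs_fps (\<lambda>n. norm (B $ n))"
  have AB: "fps_conv_radius (?A * ?B) > 0"
    using A B fps_conv_radius_norm[of A] fps_conv_radius_norm[of B]
    by (intro fps_conv_radius_mult_pos) metis+
  have si: "summable (\<lambda>m. \<integral>s. norm (c m s) \<partial>lborel)"
  proof (rule summable_comparison_test')
    show "summable (\<lambda>m. \<bar>(?A * ?B) $ m\<bar> * \<bar>rl_kernel (\<alpha> * real m + (\<beta> + \<gamma>)) t\<bar>)"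
      by (rule summable_abs_rl_series[OF AB \<alpha>])
    fix m :: nat
    have q: "rl_kernel (\<alpha> * real m + (\<beta> + \<gamma>)) t \<ge> 0"
      using \<alpha> \<beta> \<gamma> by (intro rl_kernel_nonneg) auto
    have "has_bochner_integral lborel (\<lambda>s. \<Sum>i\<le>m. \<bar>a i (t - s) * b (m - i) s\<bar>)
            (\<Sum>i\<le>m. \<bar>A $ i * B $ (m - i)\<bar> * rl_kernel (\<alpha> * real (i + (m - i)) + (\<beta> + \<gamma>)) t)"
      by (intro has_bochner_integral_sum nab)
    also have "\<dots> = (?A * ?B) $ m * rl_kernel (\<alpha> * real m + (\<beta> + \<gamma>)) t"
      by (simp add: fps_mult_nth sum_distrib_right atLeast0AtMost abs_mult)
    finally have *: "has_bochner_integral lborel (\<lambda>s. \<Sum>i\<le>m. \<bar>a i (t - s) * b (m - i) s\<bar>) \<dots>" .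
    have "(\<integral>s. norm (c m s) \<partial>lborel) \<le> (\<integral>s. (\<Sum>i\<le>m. \<bar>a i (t - s) * b (m - i) s\<bar>) \<partial>lborel)"
    proof (rule integral_mono)
      show "integrable lborel (\<lambda>s. norm (c m s))" using int_c by simp
      show "integrable lborel (\<lambda>s. \<Sum>i\<le>m. \<bar>a i (t - s) * b (m - i) s\<bar>)"
        using * by (simp add: has_bochner_integral_iff)
    qed (simp add: c_def)
    also have "\<dots> = (?A * ?B) $ m * rl_kernel (\<alpha> * real m + (\<beta> + \<gamma>)) t"
      using * by (simp add: has_bochner_integral_iff)
    also have "\<dots> \<le> \<bar>(?A * ?B) $ m\<bar> * \<bar>rl_kernel (\<alpha> * real m + (\<beta> + \<gamma>)) t\<bar>"
      using q by (simp add: mult_right_mono)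
    finally show "norm (\<integral>s. norm (c m s) \<partial>lborel) \<le> \<bar>(?A * ?B) $ m\<bar> * \<bar>rl_kernel (\<alpha> * real m + (\<beta> + \<gamma>)) t\<bar>"
      by simp
  qed
  have suminf_c: "(\<lambda>s. \<Sum>m. c m s) = (\<lambda>s. rl_series \<alpha> \<beta> A (t - s) * rl_series \<alpha> \<gamma> B s)"
    using sums by (auto simp: sums_iff)
  have "has_bochner_integral lborel (\<lambda>s. \<Sum>m. c m s) (\<Sum>m. integral\<^sup>L lborel (c m))"
    using integrable_suminf[of lborel c] integral_suminf[of lborel c] int_c sc si
    by (simp add: has_bochner_integral_iff)
  also have "(\<Sum>m. integral\<^sup>L lborel (c m)) = rl_series \<alpha> (\<beta> + \<gamma>) (A * B) t"
    unfolding rl_series_def using c by (intro suminf_cong) (simp add: has_bochner_integral_iff)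
  finally show ?thesis by (simp only: suminf_c)
qed

lemma rl_series_diff:
  assumes "fps_conv_radius A > 0" "fps_conv_radius B > 0" "\<alpha> > 0"
  shows "rl_series \<alpha> \<beta> (A - B) t = rl_series \<alpha> \<beta> A t - rl_series \<alpha> \<beta> B t"
  unfolding rl_series_def using assms
  by (subst suminf_diff) (auto intro!: summable_rl_series simp: left_diff_distrib)

lemma rl_series_cmult:
  assumes "fps_conv_radius A > 0" "\<alpha> > 0"
  shows "rl_series \<alpha> \<beta> (fps_const c * A) t = c * rl_series \<alpha> \<beta> A t"
  unfolding rl_series_def using summable_rl_series[OF assms, of \<beta> t]
  by (subst suminf_mult[symmetric]) (auto simp: mult_ac)

lemma rl_series_X_mult:
  assumes "fps_conv_radius A > 0" "\<alpha> > 0"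
  shows "rl_series \<alpha> \<beta> (fps_X * A) t = rl_series \<alpha> (\<alpha> + \<beta>) A t"
proof -
  have "fps_conv_radius (fps_X * A) > 0"
    using assms by (intro fps_conv_radius_mult_pos) auto
  from suminf_split_head[OF summable_rl_series[OF this assms(2), of \<beta> t]]
  show ?thesis by (simp add: rl_series_def algebra_simps)
qed

lemma rl_series_1: "rl_series \<alpha> \<beta> 1 t = rl_kernel \<beta> t"
  unfolding rl_series_def by (subst suminf_finite[of "{0}"]) auto

text \<open>
  Up to the factor \<open>t powr (\<beta> - 1)\<close>, the series is an entire power series in \<open>t powr \<alpha>\<close>. Continuity
  away from 0 and the behaviour at 0 are read off from this form.
\<close>
lemma rl_kernel_powser_term:
  assumes "t > 0"
  shows "a * rl_kernel (\<alpha> * real m + \<beta>) t = t powr (\<beta> - 1) * (a / Gamma (\<alpha> * real m + \<beta>) * (t powr \<alpha>) ^ m)"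
proof -
  have "t powr (\<alpha> * real m + \<beta> - 1) = t powr (\<beta> - 1) * (t powr \<alpha>) ^ m"
    using assms by (simp flip: powr_realpow powr_add add: powr_powr algebra_simps)
  thus ?thesis
    using assms by (simp add: rl_kernel_def)
qed

lemma summable_rl_powser:
  fixes y :: real
  assumes "fps_conv_radius A > 0" "\<alpha> > 0"
  shows "summable (\<lambda>m. A $ m / Gamma (\<alpha> * real m + \<beta>) * y ^ m)"
proof -
  define t where "t = (\<bar>y\<bar> + 1) powr (1 / \<alpha>)"
  have t: "t > 0" "t powr \<alpha> = \<bar>y\<bar> + 1"
    using assms by (simp_all add: t_def powr_powr)
  have "summable (\<lambda>m. t powr (\<beta> - 1) * (A $ m / Gamma (\<alpha> * real m + \<beta>) * (\<bar>y\<bar> + 1) ^ m))"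
    using summable_rl_series[OF assms, of \<beta> t]
    unfolding rl_kernel_powser_term[OF t(1)] t(2) .
  hence "summable (\<lambda>m. A $ m / Gamma (\<alpha> * real m + \<beta>) * (\<bar>y\<bar> + 1) ^ m)"
    by (rule summable_mult_D) (use t(1) in simp)
  thus ?thesis
    by (rule powser_inside) auto
qed

lemma rl_powser_isCont:
  assumes "fps_conv_radius A > 0" "\<alpha> > 0"
  shows "isCont (\<lambda>y. \<Sum>m. A $ m / Gamma (\<alpha> * real m + \<beta>) * y ^ m) y"
  by (rule isCont_powser_converges_everywhere) (rule summable_rl_powser[OF assms])

lemma rl_series_powser:
  assumes "fps_conv_radius A > 0" "\<alpha> > 0" "t > 0"
  shows "rl_series \<alpha> \<beta> A t = t powr (\<beta> - 1) * (\<Sum>m. A $ m / Gamma (\<alpha> * real m + \<beta>) * (t powr \<alpha>) ^ m)"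
  unfolding rl_series_def rl_kernel_powser_term[OF assms(3)]
  by (rule suminf_mult) (rule summable_rl_powser[OF assms(1,2)])

lemma continuous_on_rl_series:
  assumes "fps_conv_radius A > 0" "\<alpha> > 0"
  shows "continuous_on {0<..} (rl_series \<alpha> \<beta> A)"
proof -
  let ?P = "\<lambda>y. \<Sum>m. A $ m / Gamma (\<alpha> * real m + \<beta>) * y ^ m"
  have "continuous_on UNIV ?P"
    using rl_powser_isCont[OF assms] by (simp add: continuous_on_eq_continuous_at)
  moreover have pw: "continuous_on {0<..} (\<lambda>t::real. t powr e)" for e
    by (intro continuous_on_powr continuous_on_id continuous_on_const) auto
  ultimately have "continuous_on {0<..} (\<lambda>t. ?P (t powr \<alpha>))"
    by (rule continuous_on_compose2) auto
  hence "continuous_on {0<..} (\<lambda>t. t powr (\<beta> - 1) * ?P (t powr \<alpha>))"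
    by (intro continuous_on_mult pw)
  thus ?thesis
    by (rule continuous_on_eq) (simp add: rl_series_powser[OF assms])
qed

lemma rl_series_pos_near_0:
  assumes "fps_conv_radius A > 0" "\<alpha> > 0" "\<beta> > 0" "A $ 0 > 0"
  shows "eventually (\<lambda>t. rl_series \<alpha> \<beta> A t > 0) (at_right 0)"
proof -
  let ?P = "\<lambda>y. \<Sum>m. A $ m / Gamma (\<alpha> * real m + \<beta>) * y ^ m"
  have P0: "?P 0 > 0"
    unfolding powser_zero using assms Gamma_real_pos[OF assms(3)] by simp
  have "eventually (\<lambda>t::real. t \<ge> 0) (at_right 0)"
    using eventually_at_right_less[of "0::real"] by eventually_elim simp
  hence "((\<lambda>t. t powr \<alpha>) \<longlongrightarrow> 0 powr \<alpha>) (at_right (0::real))"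
    using assms by (intro tendsto_powr' tendsto_const tendsto_ident_at) auto
  hence "((\<lambda>t. t powr \<alpha>) \<longlongrightarrow> 0) (at_right (0::real))" by simp
  hence "((\<lambda>t. ?P (t powr \<alpha>)) \<longlongrightarrow> ?P 0) (at_right 0)"
    using rl_powser_isCont[OF assms(1,2), where \<beta> = \<beta> and y = 0] by (rule isCont_tendsto_compose[rotated])
  from order_tendstoD(1)[OF this P0] eventually_at_right_less[of 0] show ?thesis
    by eventually_elim (simp add: rl_series_powser[OF assms(1,2)])
qed

section \<open>Positivity of the Volterra resolvent\<close>

lemma rl_kernel_ratio:
  assumes "u > 0" "v > 0"
  shows "rl_kernel \<alpha> v = (u / v) powr (1 - \<alpha>) * rl_kernel \<alpha> u"
proof -
  have "u powr (1 - \<alpha>) * u powr (\<alpha> - 1) = 1"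
    using assms by (simp flip: powr_add)
  moreover have "v powr (\<alpha> - 1) = 1 / v powr (1 - \<alpha>)"
    using powr_minus_divide[of v "1 - \<alpha>"] by simp
  ultimately show ?thesis
    using assms by (simp add: rl_kernel_def powr_divide)
qed

text \<open>
  Let \<open>k = c q\<^sub>\<alpha>\<close> and \<open>g = k - k * g\<close>, and suppose that \<open>t\<^sub>0\<close> is the first point with \<open>g(t\<^sub>0) \<le> 0\<close>.
  For \<open>t < t\<^sub>0\<close> put \<open>\<rho> = k(t\<^sub>0)/k(t)\<close>. As \<open>k\<close> is log-convex, \<open>k(t\<^sub>0 - s) \<le> \<rho> k(t - s)\<close> for \<open>0 < s < t\<close>, so
  the part of \<open>(k * g)(t\<^sub>0)\<close> over \<open>[0,t]\<close> is at most \<open>\<rho> (k * g)(t) = \<rho> (k(t) - g(t)) = k(t\<^sub>0) - \<rho> g(t)\<close>.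
  If \<open>g\<close> takes its maximum on a short interval ending in \<open>t\<^sub>0\<close> at \<open>t\<close>, then the remaining part is at
  most \<open>g(t)\<close> times a small mass of \<open>k\<close>. Together \<open>g(t\<^sub>0) \<ge> (\<rho> - small) g(t) > 0\<close>, a contradiction.
\<close>
lemma volterra_resolvent_pos:
  fixes g :: "real \<Rightarrow> real"
  assumes \<alpha>: "0 < \<alpha>" "\<alpha> \<le> 1" and c: "c > 0"
    and cont: "continuous_on {0<..} g" and zero: "\<And>t. t \<le> 0 \<Longrightarrow> g t = 0"
    and near0: "eventually (\<lambda>t. g t > 0) (at_right 0)"
    and eq: "\<And>t. has_bochner_integral lborel (\<lambda>s. c * rl_kernel \<alpha> (t - s) * g s) (c * rl_kernel \<alpha> t - g t)"
    and T: "T > 0"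
  shows "g T > 0"
proof (rule ccontr)
  assume neg: "\<not> g T > 0"
  obtain \<epsilon> where \<epsilon>: "\<epsilon> > 0" "\<And>t. 0 < t \<Longrightarrow> t < \<epsilon> \<Longrightarrow> g t > 0"
    using near0 unfolding eventually_at_right_field by auto
  have "\<epsilon> \<le> T" using \<epsilon>(2)[OF T] neg by force
  define K where "K = {\<epsilon>..T} \<inter> g -` {..0}"
  have "closed K"
    unfolding K_def using \<epsilon>
    by (intro continuous_closed_preimage continuous_on_subset[OF cont]) auto
  moreover have "bounded K"
    unfolding K_def by (intro bounded_Int) auto
  ultimately have "compact K" by (simp add: compact_eq_bounded_closed)
  moreover have "T \<in> K" using neg \<open>\<epsilon> \<le> T\<close> by (auto simp: K_def)
  ultimately obtain t0 where t0: "t0 \<in> K" "\<And>t. t \<in> K \<Longrightarrow> t0 \<le> t"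
    using compact_attains_inf[of K] by blast
  have t0_pos: "t0 > 0" and g_t0: "g t0 \<le> 0"
    using t0(1) \<epsilon> by (auto simp: K_def)
  have pos: "g s > 0" if "0 < s" "s < t0" for s
  proof (cases "s < \<epsilon>")
    case False
    with t0(1) that t0(2)[of s] show ?thesis
      by (force simp: K_def not_less)
  qed (use \<epsilon> that in auto)

  \<comment> \<open>The second entry makes the mass of \<open>c * rl_kernel \<alpha>\<close> on \<open>[0, \<delta>]\<close> at most 1/4; the first one
    gives \<open>\<rho> \<ge> 1/2\<close> below.\<close>
  define \<delta> where "\<delta> = min (t0 / 2) ((Gamma (\<alpha> + 1) / (4 * c)) powr (1 / \<alpha>))"
  have Gam: "Gamma (\<alpha> + 1) > 0" using \<alpha> by (intro Gamma_real_pos) auto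
  have \<delta>: "\<delta> > 0" "\<delta> \<le> t0 / 2" using Gam c t0_pos by (auto simp: \<delta>_def)
  have "\<delta> powr \<alpha> \<le> ((Gamma (\<alpha> + 1) / (4 * c)) powr (1 / \<alpha>)) powr \<alpha>"
    using \<alpha> \<delta> by (intro powr_mono2) (auto simp: \<delta>_def)
  also have "\<dots> = Gamma (\<alpha> + 1) / (4 * c)"
    using \<alpha> c Gam by (simp add: powr_powr)
  finally have mass: "c * rl_kernel (\<alpha> + 1) \<delta> \<le> 1 / 4"
    using \<delta> c Gam by (simp add: rl_kernel_def field_simps)

  \<comment> \<open>The maximum is taken over \<open>[t0 - \<delta>/2, t0]\<close> rather than \<open>[t0 - \<delta>, t0]\<close>, so that \<open>s \<ge> t\<close>
    implies the strict inequality \<open>s > t0 - \<delta>\<close>, as \<open>rl_kernel 1\<close> vanishes at 0.\<close>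
  have "\<exists>t\<in>{t0 - \<delta> / 2..t0}. \<forall>s\<in>{t0 - \<delta> / 2..t0}. g s \<le> g t"
    using \<delta> by (intro continuous_attains_sup continuous_on_subset[OF cont]) auto
  then obtain t where t: "t0 - \<delta> / 2 \<le> t" "t \<le> t0"
    and max: "\<And>s. t0 - \<delta> / 2 \<le> s \<Longrightarrow> s \<le> t0 \<Longrightarrow> g s \<le> g t" by auto
  have M: "g t > 0"
    using max[of "t0 - \<delta> / 2"] pos[of "t0 - \<delta> / 2"] \<delta> by auto
  hence tt: "0 < t" "t < t0" using g_t0 t \<delta> by (auto simp: order.strict_iff_order)

  define \<rho> where "\<rho> = rl_kernel \<alpha> t0 / rl_kernel \<alpha> t"
  have k_pos: "rl_kernel \<alpha> t > 0"
    using tt Gamma_real_pos[OF \<alpha>(1)] by (simp add: rl_kernel_def)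
  have \<rho>_eq: "\<rho> = (t / t0) powr (1 - \<alpha>)"
    using k_pos rl_kernel_ratio[of t t0 \<alpha>] tt by (simp add: \<rho>_def)
  have "1 / 2 \<le> t / t0" using t tt \<delta> by (simp add: field_simps)
  also have "t / t0 = (t / t0) powr 1" using tt by simp
  also have "\<dots> \<le> \<rho>"
    unfolding \<rho>_eq using tt \<alpha> by (intro powr_mono') auto
  finally have \<rho>: "\<rho> \<ge> 1 / 2" .

  have shift: "has_bochner_integral lborel (\<lambda>s. rl_kernel \<alpha> (t0 - s) * rl_kernel 1 (s - (t0 - \<delta>)))
                 (rl_kernel (\<alpha> + 1) \<delta>)"
    using lborel_has_bochner_integral_real_affine_iff[THEN iffD1, OF _ rl_kernel_convolution[of \<alpha> 1 \<delta>],
        of 1 "- (t0 - \<delta>)"] \<alpha>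
    by (simp add: algebra_simps)
  have rhs: "has_bochner_integral lborel (\<lambda>s. \<rho> * (c * rl_kernel \<alpha> (t - s) * g s)
                 + g t * c * (rl_kernel \<alpha> (t0 - s) * rl_kernel 1 (s - (t0 - \<delta>))))
               (\<rho> * (c * rl_kernel \<alpha> t - g t) + g t * c * rl_kernel (\<alpha> + 1) \<delta>)"
    by (rule has_bochner_integral_add[OF has_bochner_integral_mult_right[OF eq[of t]]
        has_bochner_integral_mult_right[OF shift]])
  have "c * rl_kernel \<alpha> t0 - g t0
      = (\<integral>s. c * rl_kernel \<alpha> (t0 - s) * g s \<partial>lborel)"
    using eq[of t0] by (simp add: has_bochner_integral_iff)
  also have "\<dots> \<le> (\<integral>s. \<rho> * (c * rl_kernel \<alpha> (t - s) * g s)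
                 + g t * c * (rl_kernel \<alpha> (t0 - s) * rl_kernel 1 (s - (t0 - \<delta>))) \<partial>lborel)"
  proof (rule integral_mono)
    show "integrable lborel (\<lambda>s. c * rl_kernel \<alpha> (t0 - s) * g s)"
      using eq[of t0] by (simp add: has_bochner_integral_iff)
    show "integrable lborel (\<lambda>s. \<rho> * (c * rl_kernel \<alpha> (t - s) * g s)
                 + g t * c * (rl_kernel \<alpha> (t0 - s) * rl_kernel 1 (s - (t0 - \<delta>))))"
      using rhs unfolding has_bochner_integral_iff by blast
    fix s
    have nn: "rl_kernel \<alpha> u \<ge> 0" "rl_kernel 1 u \<ge> 0" for u
      using \<alpha> by (auto intro: rl_kernel_nonneg)
    have r2: "0 \<le> g t * c * (rl_kernel \<alpha> (t0 - s) * rl_kernel 1 (s - (t0 - \<delta>)))"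
      using M c nn by auto
    consider "s \<le> 0" | "0 < s" "s < t" | "t \<le> s" "s < t0" | "s \<ge> t0" by linarith
    thus "c * rl_kernel \<alpha> (t0 - s) * g s \<le> \<rho> * (c * rl_kernel \<alpha> (t - s) * g s)
                 + g t * c * (rl_kernel \<alpha> (t0 - s) * rl_kernel 1 (s - (t0 - \<delta>)))"
    proof cases
      case 1
      with r2 zero[of s] show ?thesis by simp
    next
      case 2
      \<comment> \<open>Here the log-convexity of the kernel enters, through \<open>\<alpha> \<le> 1\<close>.\<close>
      have "(t - s) / (t0 - s) \<le> t / t0"
        using 2 tt by (simp add: field_simps mult_left_mono)
      hence "((t - s) / (t0 - s)) powr (1 - \<alpha>) \<le> \<rho>"
        unfolding \<rho>_eq using 2 tt \<alpha> by (intro powr_mono2) auto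
      moreover have "rl_kernel \<alpha> (t0 - s) = ((t - s) / (t0 - s)) powr (1 - \<alpha>) * rl_kernel \<alpha> (t - s)"
        using 2 tt by (intro rl_kernel_ratio) auto
      ultimately have "rl_kernel \<alpha> (t0 - s) \<le> \<rho> * rl_kernel \<alpha> (t - s)"
        using nn by (simp add: mult_right_mono)
      hence "c * g s * rl_kernel \<alpha> (t0 - s) \<le> c * g s * (\<rho> * rl_kernel \<alpha> (t - s))"
        using c pos[of s] 2 tt by (intro mult_left_mono) auto
      with r2 show ?thesis by (simp add: mult_ac)
    next
      case 3
      have "g s \<le> g t" using 3 t max[of s] by auto
      hence "c * rl_kernel \<alpha> (t0 - s) * g s \<le> c * rl_kernel \<alpha> (t0 - s) * g t"
        using c nn by (intro mult_left_mono) auto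
      moreover have "rl_kernel 1 (s - (t0 - \<delta>)) = 1"
        using 3 t \<delta> by (simp add: rl_kernel_1)
      moreover have "rl_kernel \<alpha> (t - s) = 0" using 3 by (simp add: rl_kernel_def)
      ultimately show ?thesis by (simp add: mult_ac)
    next
      case 4
      thus ?thesis using tt by (simp add: rl_kernel_def)
    qed
  qed
  also have "\<dots> = \<rho> * (c * rl_kernel \<alpha> t - g t) + g t * c * rl_kernel (\<alpha> + 1) \<delta>"
    using rhs unfolding has_bochner_integral_iff by blast
  also have "\<rho> * (c * rl_kernel \<alpha> t - g t) = c * rl_kernel \<alpha> t0 - \<rho> * g t"
    using k_pos by (simp add: \<rho>_def field_simps)
  finally have "\<rho> * g t \<le> g t * (c * rl_kernel (\<alpha> + 1) \<delta>)" using g_t0 by simp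
  also have "\<dots> \<le> g t * (1 / 4)" using M mass by (intro mult_left_mono) auto
  finally have "\<rho> \<le> 1 / 4" using M by (simp add: field_simps)
  with \<rho> show False by simp
qed

section \<open>The relaxation series and Mittag-Leffler functions\<close>

text \<open>
  The rational function \<open>cX/(1 + cX)\<close>. Its image is the Mittag-Leffler waiting time density
  \<open>c t\<^bsup>\<alpha>-1\<^esup> E\<^bsub>\<alpha>,\<alpha>\<^esub>(-c t\<^sup>\<alpha>)\<close> of fractional relaxation.
\<close>
definition relax_fps :: "real \<Rightarrow> real fps" where
  "relax_fps c = fps_const c * fps_X * inverse (1 + fps_const c * fps_X)"

lemma relax_fps_nth_0 [simp]: "relax_fps c $ 0 = 0"
  by (simp add: relax_fps_def mult.assoc)

lemma inverse_linear_fps_pos: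
  "fps_conv_radius (inverse ((1 - fps_const c * fps_X) ^ k) :: real fps) > 0"
proof (rule fps_conv_radius_inverse_pos)
  have "fps_conv_radius (1 - fps_const c * fps_X :: real fps) > 0"
    by (rule less_le_trans[OF _ fps_conv_radius_diff])
       (simp add: fps_conv_radius_mult_pos)
  thus "fps_conv_radius ((1 - fps_const c * fps_X) ^ k :: real fps) > 0"
    by (rule fps_conv_radius_power_pos)
qed (simp add: fps_power_zeroth)

lemma relax_fps_power:
  "relax_fps c ^ k = fps_const (c ^ k) * (fps_X ^ k * inverse ((1 - fps_const (- c) * fps_X) ^ k))"
  by (simp add: relax_fps_def power_mult_distrib fps_inverse_power fps_const_power mult.assoc
        flip: fps_const_neg)

lemma relax_fps_conv_radius: "fps_conv_radius (relax_fps c) > 0"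
  using relax_fps_power[of c 1] inverse_linear_fps_pos[of "-c" 1]
  by (simp add: fps_conv_radius_mult_pos)

text \<open>
  The image of this identity is the Volterra equation \<open>g = k - k * g\<close>.
\<close>
lemma relax_fps_eq: "relax_fps c = fps_const c * fps_X - fps_const c * fps_X * relax_fps c"
proof -
  have "inverse (1 + fps_const c * fps_X) * (1 + fps_const c * fps_X :: real fps) = 1"
    by (rule inverse_mult_eq_1) simp
  hence "relax_fps c * (1 + fps_const c * fps_X) = fps_const c * fps_X"
    by (simp add: relax_fps_def mult.assoc)
  thus ?thesis by (simp add: algebra_simps)
qed

text \<open>
  The first coefficient \<open>c\<close> dominates near 0. To see this, split off the factor \<open>X\<close>, which is absorbed
  by \<open>\<beta> = \<alpha>\<close>; the constant coefficient of the remaining series is \<open>c > 0\<close>.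
\<close>
lemma rl_series_relax_fps_pos:
  assumes \<alpha>: "0 < \<alpha>" "\<alpha> \<le> 1" and c: "c > 0" and t: "t > 0"
  shows "rl_series \<alpha> 0 (relax_fps c) t > 0"
proof (rule volterra_resolvent_pos[OF \<alpha> c _ _ _ _ t])
  let ?I = "inverse (1 + fps_const c * fps_X) :: real fps"
  have I: "fps_conv_radius ?I > 0"
    using inverse_linear_fps_pos[of "-c" 1] by (simp flip: fps_const_neg)
  have cI: "fps_conv_radius (fps_const c * ?I) > 0"
    by (intro fps_conv_radius_mult_pos I) simp
  show "continuous_on {0<..} (rl_series \<alpha> 0 (relax_fps c))"
    by (intro continuous_on_rl_series relax_fps_conv_radius \<alpha>)
  show "rl_series \<alpha> 0 (relax_fps c) t = 0" if "t \<le> 0" for t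
    using that by (rule rl_series_eq_0)
  have "rl_series \<alpha> 0 (relax_fps c) s = rl_series \<alpha> \<alpha> (fps_const c * ?I) s" for s
    using rl_series_X_mult[OF cI \<alpha>(1), of 0 s] by (simp add: relax_fps_def mult_ac)
  moreover have "eventually (\<lambda>s. rl_series \<alpha> \<alpha> (fps_const c * ?I) s > 0) (at_right 0)"
    by (rule rl_series_pos_near_0[OF cI \<alpha>(1) \<alpha>(1)]) (use c in simp)
  ultimately show "eventually (\<lambda>s. rl_series \<alpha> 0 (relax_fps c) s > 0) (at_right 0)"
    by simp
  have cX: "fps_conv_radius (fps_const c * fps_X) > 0"
    by (intro fps_conv_radius_mult_pos) simp_all
  have k: "rl_series \<alpha> 0 (fps_const c * fps_X) s = c * rl_kernel \<alpha> s" for s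
    using rl_series_cmult[of fps_X \<alpha> 0 c s] rl_series_X_mult[of 1 \<alpha> 0 s] \<alpha>
    by (simp add: rl_series_1)
  fix t
  have "has_bochner_integral lborel
          (\<lambda>s. rl_series \<alpha> 0 (fps_const c * fps_X) (t - s) * rl_series \<alpha> 0 (relax_fps c) s)
          (rl_series \<alpha> (0 + 0) (fps_const c * fps_X * relax_fps c) t)"
    by (intro rl_series_convolution cX relax_fps_conv_radius \<alpha>) auto
  also have "fps_const c * fps_X * relax_fps c = fps_const c * fps_X - relax_fps c"
    using relax_fps_eq[of c] by (simp add: algebra_simps)
  also have "rl_series \<alpha> (0 + 0) \<dots> t = c * rl_kernel \<alpha> t - rl_series \<alpha> 0 (relax_fps c) t"
    by (simp add: rl_series_diff cX relax_fps_conv_radius \<alpha> k)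
  finally show "has_bochner_integral lborel (\<lambda>s. c * rl_kernel \<alpha> (t - s) * rl_series \<alpha> 0 (relax_fps c) s)
                  (c * rl_kernel \<alpha> t - rl_series \<alpha> 0 (relax_fps c) t)"
    by (simp add: k)
qed

lemma rl_series_relax_fps_power_nonneg:
  assumes \<alpha>: "0 < \<alpha>" "\<alpha> \<le> 1" and c: "c > 0"
  shows "rl_series \<alpha> 0 (relax_fps c ^ Suc n) t \<ge> 0"
proof (induction n arbitrary: t)
  case 0
  show ?case
    using rl_series_relax_fps_pos[OF assms, of t] rl_series_eq_0[of t \<alpha> 0 "relax_fps c"]
    by (cases "t > 0") auto
next
  case (Suc n)
  let ?f = "\<lambda>s. rl_series \<alpha> 0 (relax_fps c) (t - s) * rl_series \<alpha> 0 (relax_fps c ^ Suc n) s"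
  have "has_bochner_integral lborel ?f (rl_series \<alpha> (0 + 0) (relax_fps c * relax_fps c ^ Suc n) t)"
    by (intro rl_series_convolution fps_conv_radius_power_pos relax_fps_conv_radius \<alpha>) auto
  hence "rl_series \<alpha> 0 (relax_fps c ^ Suc (Suc n)) t = integral\<^sup>L lborel ?f"
    by (simp add: has_bochner_integral_iff)
  moreover have "rl_series \<alpha> 0 (relax_fps c) s \<ge> 0" for s
    using rl_series_relax_fps_pos[OF assms, of s] rl_series_eq_0[of s \<alpha> 0 "relax_fps c"]
    by (cases "s > 0") auto
  hence "integral\<^sup>L lborel ?f \<ge> 0"
    by (intro Bochner_Integration.integral_nonneg mult_nonneg_nonneg Suc.IH)
  ultimately show ?case by simp
qed

text \<open>
  The coefficients of \<open>(1 - cX)\<^bsup>-k\<^esup>\<close> are \<open>((k + j - 1) choose j) c\<^sup>j = \<Gamma>(j + k) c\<^sup>j/(\<Gamma>(k) j!)\<close>, as in the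
  definition of the three-parameter function.
\<close>
lemma rl_series_mittag_leffler3:
  assumes \<alpha>: "\<alpha> > 0" and k: "k \<ge> 1" and t: "t > 0"
  shows "rl_series \<alpha> \<beta> (fps_X ^ p * inverse ((1 - fps_const c * fps_X) ^ k)) t =
           t powr (\<alpha> * real p + \<beta> - 1) * mittag_leffler3 \<alpha> (\<alpha> * real p + \<beta>) (real k) (c * t powr \<alpha>)"
proof -
  define A :: "real fps" where "A = fps_X ^ p * inverse ((1 - fps_const c * fps_X) ^ k)"
  have A_nth: "A $ m = (if m < p then 0 else real ((k + (m - p) - 1) choose (m - p)) * c ^ (m - p))" for m
    using k by (simp add: A_def fps_X_power_mult_nth one_minus_const_fps_X_neg_power')
  have A: "fps_conv_radius A > 0"
    unfolding A_def by (intro fps_conv_radius_mult_pos inverse_linear_fps_pos) simp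
  let ?T = "\<lambda>j. Gamma (real j + real k) * (c * t powr \<alpha>) ^ j / (fact j * Gamma (real j * \<alpha> + (\<alpha> * real p + \<beta>)))"
  let ?C = "t powr (\<alpha> * real p + \<beta> - 1) * (1 / Gamma (real k))"
  have Gk: "Gamma (real k) > 0" using k by (intro Gamma_real_pos) simp
  have C: "?C \<noteq> 0" using Gk t by simp
  have trm: "A $ (j + p) * rl_kernel (\<alpha> * real (j + p) + \<beta>) t = ?C * ?T j" for j
  proof -
    obtain k' where k': "k = Suc k'" using k by (cases k) auto
    have "real ((k' + j) choose j) = fact (k' + j) / (fact j * fact k')"
      by (simp add: binomial_fact)
    moreover have "Gamma (real j + real k) = fact (k' + j)" "Gamma (real k) = fact k'"
      using Gamma_fact[of "k' + j", where ?'a = real] Gamma_fact[of k', where ?'a = real]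
      by (simp_all add: k' algebra_simps)
    moreover have "t powr (\<alpha> * real (j + p) + \<beta> - 1) = t powr (\<alpha> * real p + \<beta> - 1) * (t powr \<alpha>) ^ j"
      using t by (simp flip: powr_realpow powr_add add: powr_powr algebra_simps)
    moreover have "A $ (j + p) = real ((k' + j) choose j) * c ^ j"
      by (simp add: A_nth k')
    ultimately show ?thesis
      using t by (simp add: rl_kernel_def power_mult_distrib algebra_simps)
  qed
  have "(\<lambda>m. A $ m * rl_kernel (\<alpha> * real m + \<beta>) t) sums rl_series \<alpha> \<beta> A t"
    using summable_rl_series[OF A \<alpha>] by (simp add: rl_series_def summable_sums)
  hence "(\<lambda>j. A $ (j + p) * rl_kernel (\<alpha> * real (j + p) + \<beta>) t) sums rl_series \<alpha> \<beta> A t"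
    by (rule sums_zero_iff_shift[THEN iffD2, rotated]) (simp add: A_nth)
  hence S: "(\<lambda>j. ?C * ?T j) sums rl_series \<alpha> \<beta> A t"
    unfolding trm .
  have "summable ?T"
    by (rule summable_mult_D[OF sums_summable[OF S] C])
  hence "suminf (\<lambda>j. ?C * ?T j) = ?C * suminf ?T"
    by (rule suminf_mult)
  hence "rl_series \<alpha> \<beta> A t = ?C * suminf ?T"
    using sums_unique[OF S] by (rule trans[rotated])
  thus ?thesis
    by (simp only: A_def mittag_leffler3_def mult.assoc)
qed

section \<open>Summation over the number of renewals\<close>

lemma relax_fps_power_nth:
  assumes "k \<ge> 1"
  shows "(relax_fps c ^ k) $ m = (if m < k then 0 else real ((m - 1) choose (m - k)) * (- 1) ^ (m - k) * c ^ m)"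
proof -
  have k: "k > 0" using assms by simp
  show ?thesis
    unfolding relax_fps_power one_minus_const_fps_X_neg_power'[OF k] fps_mult_left_const_nth fps_X_power_mult_nth
    using assms by (auto simp: not_less power_minus[of c] simp flip: power_add)
qed

text \<open>
  For \<open>c \<ge> 0\<close>, the sign of the \<open>m\<close>-th coefficient of an even power is \<open>(-1)\<^sup>m\<close>, which is absorbed by changing the sign of
  \<open>c\<close>. Hence absolute values do not leave the family of series under consideration.
\<close>
lemma relax_fps_even_power_nth_abs:
  assumes "k \<ge> 1" "even k" "c \<ge> 0"
  shows "\<bar>(relax_fps c ^ k) $ m\<bar> = (relax_fps (- c) ^ k) $ m"
proof -
  have "(- 1) ^ (m - k) * (- c) ^ m = c ^ m" if "m \<ge> k"
    using that assms(2) by (auto simp: power_minus[of c] simp flip: power_add mult.assoc)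
  thus ?thesis
    using assms by (simp add: relax_fps_power_nth abs_mult power_abs mult.assoc)
qed

lemma relax_fps_even_power_nth_nonneg:
  assumes "k \<ge> 1" "even k" "c \<ge> 0"
  shows "(relax_fps (- c) ^ k) $ m \<ge> 0"
  using relax_fps_even_power_nth_abs[OF assms, of m] by linarith

lemma binomial_column_fps:
  "fps_X ^ q * inverse ((1 - fps_X) ^ Suc q) = Abs_fps (\<lambda>n. real (n choose q))"
proof (rule fps_ext)
  fix n
  have *: "inverse ((1 - fps_X) ^ Suc q) = Abs_fps (\<lambda>k. real ((q + k) choose k))"
    using one_minus_const_fps_X_neg_power'[of "Suc q" "1 :: real"] by simp
  show "(fps_X ^ q * inverse ((1 - fps_X) ^ Suc q)) $ n = Abs_fps (\<lambda>n. real (n choose q)) $ n"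
    unfolding * fps_X_power_mult_nth by (auto simp: not_less binomial_symmetric[of q n])
qed

lemma binomial_column_fps_compose:
  fixes Y :: "real fps"
  assumes "Y $ 0 = 0"
  shows "Abs_fps (\<lambda>n. real (n choose q)) oo Y = Y ^ q * inverse ((1 - Y) ^ Suc q)"
  unfolding binomial_column_fps[symmetric] using assms
  by (subst fps_compose_mult_distrib, simp)
     (simp add: fps_inverse_compose fps_compose_power[symmetric] fps_compose_sub_distrib fps_power_zeroth del: power_Suc)

text \<open>
  The rational function \<open>(c\<^sup>2X\<^sup>2/(1 + 2cX))\<^sup>r\<close>, whose image with \<open>\<beta> = 1\<close> is the factorial moment divided by \<open>r!\<close>.
\<close>
definition moment_fps :: "real \<Rightarrow> nat \<Rightarrow> real fps" where
  "moment_fps c r = fps_const (c ^ (2 * r)) * (fps_X ^ (2 * r) * inverse ((1 - fps_const (- 2 * c) * fps_X) ^ r))"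

lemma moment_fps_conv_radius: "fps_conv_radius (moment_fps c r) > 0"
  unfolding moment_fps_def by (intro fps_conv_radius_mult_pos inverse_linear_fps_pos) simp_all

text \<open>
  With \<open>L = 1 + cX\<close> the left-hand side is \<open>c\<^sup>2X\<^sup>2/(L\<^sup>2 - c\<^sup>2X\<^sup>2)\<close>, and \<open>L\<^sup>2 - c\<^sup>2X\<^sup>2 = 1 + 2cX\<close>.
\<close>
lemma relax_fps_square_geometric:
  "(relax_fps c)\<^sup>2 * inverse (1 - (relax_fps c)\<^sup>2) = moment_fps c 1"
proof -
  let ?L = "1 + fps_const c * fps_X :: real fps" and ?D = "1 - fps_const (- 2 * c) * fps_X :: real fps"
  let ?cX = "fps_const c * fps_X :: real fps"
  have L: "inverse ?L * ?L = 1" by (rule inverse_mult_eq_1) simp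
  have D: "?D * inverse ?D = 1" by (rule inverse_mult_eq_1') simp
  have YL: "(relax_fps c)\<^sup>2 * ?L\<^sup>2 = ?cX\<^sup>2"
    using L by (simp add: relax_fps_def mult.assoc flip: power_mult_distrib)
  have "fps_const (-2 * c) = - (2 * fps_const c)"
    by (simp add: numeral_fps_const)
  hence D_eq: "?D = ?L\<^sup>2 - ?cX\<^sup>2"
    by (simp add: power2_eq_square algebra_simps)
  have "(1 - (relax_fps c)\<^sup>2) * ?L\<^sup>2 = ?D"
    using YL unfolding D_eq by (simp add: algebra_simps)
  hence "(1 - (relax_fps c)\<^sup>2) * (?L\<^sup>2 * inverse ?D) = 1"
    using D by (simp flip: mult.assoc)
  hence "inverse (1 - (relax_fps c)\<^sup>2) = ?L\<^sup>2 * inverse ?D"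
    by (rule fps_inverse_unique)
  hence "(relax_fps c)\<^sup>2 * inverse (1 - (relax_fps c)\<^sup>2) = ?cX\<^sup>2 * inverse ?D"
    by (simp only: YL flip: mult.assoc)
  thus ?thesis
    by (simp add: moment_fps_def power_mult_distrib fps_const_power mult.assoc)
qed

lemma moment_fps_power: "moment_fps c 1 ^ r = moment_fps c r"
  by (simp add: moment_fps_def power_mult_distrib fps_const_power fps_inverse_power flip: power_mult)

text \<open>
  Every coefficient of \<open>\<Sum>\<^sub>n (n choose q) Y\<^bsup>n+1\<^esup>\<close> with \<open>Y = (relax_fps c)\<^sup>2\<close> is a finite sum, as \<open>Y\<^bsup>n+1\<^esup>\<close> has
  no terms of degree at most \<open>n\<close>. The sum is the composition of a generating function with \<open>Y\<close>.
\<close>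
lemma binomial_sum_relax_fps_nth:
  assumes "m \<le> N"
  shows "(\<Sum>n<N. real (n choose q) * (relax_fps c ^ (2 * Suc n)) $ m) = moment_fps c (Suc q) $ m"
proof -
  let ?Y = "(relax_fps c)\<^sup>2"
  have Y0: "?Y $ 0 = 0" by (simp add: fps_power_zeroth)
  let ?H = "Abs_fps (\<lambda>n. real (n choose q))"
  have "moment_fps c (Suc q) = (?Y * inverse (1 - ?Y)) ^ Suc q"
    by (simp only: relax_fps_square_geometric moment_fps_power)
  also have "\<dots> = ?Y * (?H oo ?Y)"
    unfolding binomial_column_fps_compose[OF Y0] power_mult_distrib fps_inverse_power
    by (simp add: mult.assoc)
  also have "\<dots> = (fps_X * ?H) oo ?Y"
    using Y0 by (simp add: fps_compose_mult_distrib)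
  finally have "moment_fps c (Suc q) $ m = (\<Sum>i=0..m. (fps_X * ?H) $ i * (?Y ^ i) $ m)"
    by (simp add: fps_compose_nth)
  also have "\<dots> = (\<Sum>i\<le>N. (fps_X * ?H) $ i * (?Y ^ i) $ m)"
    using assms startsby_zero_power_prefix[OF Y0] by (intro sum.mono_neutral_left) auto
  also have "\<dots> = (\<Sum>n<N. (fps_X * ?H) $ Suc n * (?Y ^ Suc n) $ m)"
    by (subst sum.atMost_shift) simp
  finally show ?thesis
    by (simp del: power_Suc mult_Suc_right add: power_mult)
qed

text \<open>
  The coefficients of the partial sums are eventually constant, and they are dominated by those of the
  series for \<open>-c\<close>, so Tannery's theorem applies.
\<close>
lemma binomial_sum_rl_series:
  assumes \<alpha>: "\<alpha> > 0" and c: "c \<ge> 0"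
  shows "(\<lambda>n. real (n choose q) * rl_series \<alpha> \<beta> (relax_fps c ^ (2 * Suc n)) t) sums
           rl_series \<alpha> \<beta> (moment_fps c (Suc q)) t"
proof -
  define a where "a m N = (\<Sum>n<N. real (n choose q) * (relax_fps c ^ (2 * Suc n)) $ m) * rl_kernel (\<alpha> * real m + \<beta>) t" for m N
  define b where "b m = moment_fps c (Suc q) $ m * rl_kernel (\<alpha> * real m + \<beta>) t" for m
  define B where "B m = \<bar>moment_fps (- c) (Suc q) $ m\<bar> * \<bar>rl_kernel (\<alpha> * real m + \<beta>) t\<bar>" for m
  have lim: "(\<lambda>N. a m N) \<longlonglongrightarrow> b m" for m
  proof (rule tendsto_eventually)
    show "eventually (\<lambda>N. a m N = b m) sequentially"
      using eventually_ge_at_top[of m] by eventually_elim (simp only: a_def b_def binomial_sum_relax_fps_nth)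
  qed
  have bound: "norm (a m N) \<le> B m" for m N
  proof -
    have "\<bar>\<Sum>n<N. real (n choose q) * (relax_fps c ^ (2 * Suc n)) $ m\<bar>
        \<le> (\<Sum>n<N. real (n choose q) * (relax_fps (- c) ^ (2 * Suc n)) $ m)"
      by (rule order.trans[OF sum_abs])
         (simp add: abs_mult relax_fps_even_power_nth_abs c del: power_Suc mult_Suc_right)
    also have "\<dots> \<le> (\<Sum>n<max m N. real (n choose q) * (relax_fps (- c) ^ (2 * Suc n)) $ m)"
    proof (intro sum_mono2)
      show "0 \<le> real (n choose q) * (relax_fps (- c) ^ (2 * Suc n)) $ m" for n
        by (intro mult_nonneg_nonneg relax_fps_even_power_nth_nonneg c) auto
    qed auto
    also have "\<dots> = moment_fps (- c) (Suc q) $ m"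
      by (rule binomial_sum_relax_fps_nth) simp
    also have "\<dots> \<le> \<bar>moment_fps (- c) (Suc q) $ m\<bar>" by simp
    finally show ?thesis
      unfolding a_def B_def by (simp add: abs_mult mult_right_mono)
  qed
  have "summable B"
    unfolding B_def by (intro summable_abs_rl_series moment_fps_conv_radius \<alpha>)
  moreover have "eventually (\<lambda>(m, N). norm (a m N) \<le> B m) (at_top \<times>\<^sub>F sequentially)"
    using bound by (intro always_eventually) auto
  ultimately have "(\<lambda>N. \<Sum>m. a m N) \<longlonglongrightarrow> suminf b"
    using tannerys_theorem[of a b sequentially B, OF lim] by simp
  also have "suminf b = rl_series \<alpha> \<beta> (moment_fps c (Suc q)) t"
    by (simp add: b_def[abs_def] rl_series_def)
  also have "(\<lambda>N. \<Sum>m. a m N) = (\<lambda>N. \<Sum>n<N. real (n choose q) * rl_series \<alpha> \<beta> (relax_fps c ^ (2 * Suc n)) t)"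
  proof
    fix N
    have s: "summable (\<lambda>m. (relax_fps c ^ k) $ m * rl_kernel (\<alpha> * real m + \<beta>) t)" for k
      by (intro summable_rl_series fps_conv_radius_power_pos relax_fps_conv_radius \<alpha>)
    have "(\<Sum>n<N. real (n choose q) * rl_series \<alpha> \<beta> (relax_fps c ^ (2 * Suc n)) t)
        = (\<Sum>n<N. \<Sum>m. real (n choose q) * ((relax_fps c ^ (2 * Suc n)) $ m * rl_kernel (\<alpha> * real m + \<beta>) t))"
      unfolding rl_series_def by (intro sum.cong refl suminf_mult[symmetric] s)
    also have "\<dots> = (\<Sum>m. \<Sum>n<N. real (n choose q) * ((relax_fps c ^ (2 * Suc n)) $ m * rl_kernel (\<alpha> * real m + \<beta>) t))"
      by (intro suminf_sum[symmetric] summable_mult s)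
    finally show "(\<Sum>m. a m N) = (\<Sum>n<N. real (n choose q) * rl_series \<alpha> \<beta> (relax_fps c ^ (2 * Suc n)) t)"
      by (simp only: a_def sum_distrib_right mult.assoc)
  qed
  finally show ?thesis
    by (simp add: sums_def)
qed

section \<open>Renewal epochs and factorial moments\<close>

lemma falling_factorial_eq_binomial: "falling_factorial n r = fact r * real (n choose r)"
  by (simp add: falling_factorial_def binomial_gbinomial gbinomial_prod_rev lessThan_atLeast0)

lemma interarrival_density_eq_rl_series:
  assumes "\<alpha> > 0"
  shows "interarrival_density \<alpha> lam t = rl_series \<alpha> 0 (relax_fps lam ^ 2) t"
proof (cases "t > 0")
  case True
  let ?A = "fps_X ^ 2 * inverse ((1 - fps_const (- lam) * fps_X) ^ 2) :: real fps"
  have A: "fps_conv_radius ?A > 0"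
    by (intro fps_conv_radius_mult_pos inverse_linear_fps_pos) simp
  show ?thesis
    unfolding relax_fps_power rl_series_cmult[OF A assms]
    using True assms by (subst rl_series_mittag_leffler3) (simp_all add: interarrival_density_def mult_ac)
qed (simp add: interarrival_density_def rl_series_eq_0)

text \<open>
  The series 1 with \<open>\<beta> = 1\<close> is the indicator of the positive half-line, so integration over \<open>[0,t]\<close> is
  a convolution with it, up to the single point \<open>s = t\<close>.
\<close>
lemma (in prob_space) prob_le_rl_series:
  assumes \<alpha>: "\<alpha> > 0" and A: "fps_conv_radius A > 0" "A $ 0 = 0"
    and nonneg: "\<And>x. rl_series \<alpha> 0 A x \<ge> 0"
    and X: "distributed M lborel X (\<lambda>x. ennreal (rl_series \<alpha> 0 A x))"
  shows "prob {\<omega> \<in> space M. X \<omega> \<le> t} = rl_series \<alpha> 1 A t"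
proof -
  have [measurable]: "X \<in> borel_measurable M"
    using distributed_measurable[OF X] by simp
  let ?f = "\<lambda>s. rl_series \<alpha> 1 1 (t - s) * rl_series \<alpha> 0 A s"
  have conv: "has_bochner_integral lborel ?f (rl_series \<alpha> 1 A t)"
    using rl_series_convolution[of 1 A \<alpha> 1 0 t] \<alpha> A by simp
  have nn: "?f s \<ge> 0" for s
    using nonneg by (simp add: rl_series_1 rl_kernel_nonneg)
  have "emeasure M {\<omega> \<in> space M. X \<omega> \<le> t} = emeasure M (X -` {..t} \<inter> space M)"
    by (intro arg_cong[where f = "emeasure M"]) auto
  also have "\<dots> = (\<integral>\<^sup>+s. ennreal (rl_series \<alpha> 0 A s) * indicator {..t} s \<partial>lborel)"
    by (rule distributed_emeasure[OF X]) simp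
  also have "\<dots> = (\<integral>\<^sup>+s. ennreal (?f s) \<partial>lborel)"
    using AE_lborel_singleton[of t]
    by (intro nn_integral_cong_AE, elim AE_mp)
       (auto simp: rl_series_1 rl_kernel_1 indicator_def)
  also have "\<dots> = ennreal (rl_series \<alpha> 1 A t)"
    using conv nn by (simp add: has_bochner_integral_iff nn_integral_eq_integral)
  finally have "emeasure M {\<omega> \<in> space M. X \<omega> \<le> t} = ennreal (rl_series \<alpha> 1 A t)" .
  moreover have "rl_series \<alpha> 1 A t \<ge> 0"
    using conv Bochner_Integration.integral_nonneg[of lborel ?f] nn by (simp add: has_bochner_integral_iff)
  ultimately show ?thesis by (simp add: measure_def)
qed

text \<open>
  Multiplication of the power series is convolution of the densities. Nonnegativity is what allows the
  convolution of the \<open>ennreal\<close>-valued densities to be computed with the signed series.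
\<close>
lemma (in prob_space) partial_sum_distributed:
  assumes \<alpha>: "0 < \<alpha>" "\<alpha> \<le> 1" and c: "c > 0"
    and indep: "indep_vars (\<lambda>_. borel) T UNIV"
    and dist: "\<And>i. distributed M lborel (T i) (\<lambda>x. ennreal (rl_series \<alpha> 0 (relax_fps c ^ 2) x))"
  shows "distributed M lborel (\<lambda>\<omega>. \<Sum>i<Suc n. T i \<omega>) (\<lambda>x. ennreal (rl_series \<alpha> 0 (relax_fps c ^ (2 * Suc n)) x))"
proof (induction n)
  case 0
  show ?case using dist[of 0] by simp
next
  case (Suc n)
  have nonneg: "rl_series \<alpha> 0 (relax_fps c ^ (2 * Suc k)) x \<ge> 0" for k x
    using rl_series_relax_fps_power_nonneg[OF \<alpha> c, of "Suc (2 * k)" x] by simp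
  have nonneg2: "rl_series \<alpha> 0 (relax_fps c ^ 2) x \<ge> 0" for x
    using nonneg[of 0 x] by (simp add: power2_eq_square)
  have "indep_var borel (T (Suc n)) borel (\<lambda>\<omega>. \<Sum>i<Suc n. T i \<omega>)"
    by (intro indep_vars_sum indep_vars_subset[OF indep]) auto
  from distributed_convolution[OF this dist Suc.IH]
  have "distributed M lborel (\<lambda>\<omega>. T (Suc n) \<omega> + (\<Sum>i<Suc n. T i \<omega>))
     (\<lambda>x. \<integral>\<^sup>+ y. ennreal (rl_series \<alpha> 0 (relax_fps c ^ 2) (x - y)) *
              ennreal (rl_series \<alpha> 0 (relax_fps c ^ (2 * Suc n)) y) \<partial>lborel)" .
  also have "(\<lambda>x. \<integral>\<^sup>+ y. ennreal (rl_series \<alpha> 0 (relax_fps c ^ 2) (x - y)) *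
              ennreal (rl_series \<alpha> 0 (relax_fps c ^ (2 * Suc n)) y) \<partial>lborel)
     = (\<lambda>x. ennreal (rl_series \<alpha> 0 (relax_fps c ^ (2 * Suc (Suc n))) x))"
  proof
    fix x
    let ?f = "\<lambda>y. rl_series \<alpha> 0 (relax_fps c ^ 2) (x - y) * rl_series \<alpha> 0 (relax_fps c ^ (2 * Suc n)) y"
    have "has_bochner_integral lborel ?f
            (rl_series \<alpha> (0 + 0) (relax_fps c ^ 2 * relax_fps c ^ (2 * Suc n)) x)"
      by (intro rl_series_convolution fps_conv_radius_power_pos relax_fps_conv_radius \<alpha>)
         (auto simp: fps_power_zeroth)
    also have "relax_fps c ^ 2 * relax_fps c ^ (2 * Suc n) = relax_fps c ^ (2 * Suc (Suc n))"
      by (simp flip: power_add)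
    finally have conv: "has_bochner_integral lborel ?f (rl_series \<alpha> 0 (relax_fps c ^ (2 * Suc (Suc n))) x)"
      by simp
    have "(\<integral>\<^sup>+ y. ennreal (rl_series \<alpha> 0 (relax_fps c ^ 2) (x - y)) *
              ennreal (rl_series \<alpha> 0 (relax_fps c ^ (2 * Suc n)) y) \<partial>lborel) = (\<integral>\<^sup>+ y. ennreal (?f y) \<partial>lborel)"
      by (intro nn_integral_cong ennreal_mult[symmetric] nonneg nonneg2)
    also have "\<dots> = ennreal (integral\<^sup>L lborel ?f)"
      using conv by (intro nn_integral_eq_integral always_eventually allI mult_nonneg_nonneg nonneg nonneg2)
        (simp add: has_bochner_integral_iff)
    also have "integral\<^sup>L lborel ?f = rl_series \<alpha> 0 (relax_fps c ^ (2 * Suc (Suc n))) x"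
      using conv unfolding has_bochner_integral_iff by blast
    finally show "(\<integral>\<^sup>+ y. ennreal (rl_series \<alpha> 0 (relax_fps c ^ 2) (x - y)) *
              ennreal (rl_series \<alpha> 0 (relax_fps c ^ (2 * Suc n)) y) \<partial>lborel)
            = ennreal (rl_series \<alpha> 0 (relax_fps c ^ (2 * Suc (Suc n))) x)" .
  qed
  finally show ?case by (simp only: sum.lessThan_Suc[of _ "Suc n"] add.commute)
qed

lemma sum_choose_lessThan: "(\<Sum>n<N. n choose q) = N choose Suc q"
  by (induction N) auto

text \<open>
  As the epochs increase, the renewals up to time \<open>t\<close> are the first \<open>N\<close> ones, and the column of Pascal's
  triangle sums up to \<open>(N choose (q + 1))\<close>. The assumption on the tail ensures that \<open>N\<close> is finite.
\<close>
lemma renewal_count_choose_sums: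
  assumes pos: "\<And>i. T i \<omega> > 0" and fin: "eventually (\<lambda>n. (\<Sum>i<Suc n. T i \<omega>) > t) sequentially"
  shows "(\<lambda>n. real (n choose q) * of_bool ((\<Sum>i<Suc n. T i \<omega>) \<le> t)) sums
           real (renewal_count T t \<omega> choose Suc q)"
proof -
  define S where "S n = (\<Sum>i<n. T i \<omega>)" for n
  have mono: "S m \<le> S n" if "m \<le> n" for m n
    unfolding S_def using that pos by (intro sum_mono2) (auto intro: less_imp_le)
  define N where "N = (LEAST n. S (Suc n) > t)"
  have "\<exists>n. S (Suc n) > t"
    using fin by (auto simp: S_def eventually_sequentially)
  hence N: "S (Suc N) > t"
    unfolding N_def by (rule LeastI_ex)
  have iff: "S (Suc n) \<le> t \<longleftrightarrow> n < N" for n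
  proof
    assume "S (Suc n) \<le> t"
    thus "n < N" using N mono[of "Suc N" "Suc n"] by (cases "n < N") auto
  next
    assume "n < N"
    thus "S (Suc n) \<le> t" using not_less_Least[of n "\<lambda>n. S (Suc n) > t"] by (auto simp: N_def)
  qed
  have "{n. n \<ge> 1 \<and> S n \<le> t} = Suc ` {..<N}"
    by (auto simp: iff image_iff) (metis Suc_le_D iff lessThan_iff One_nat_def)
  hence "renewal_count T t \<omega> = N"
    by (simp add: renewal_count_def S_def card_image)
  moreover have "(\<lambda>n. real (n choose q) * of_bool (S (Suc n) \<le> t)) sums
     (\<Sum>n<N. real (n choose q) * of_bool (S (Suc n) \<le> t))"
    by (rule sums_finite) (auto simp: iff)
  moreover have "(\<Sum>n<N. real (n choose q) * of_bool (S (Suc n) \<le> t)) = real (N choose Suc q)"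
    unfolding sum_choose_lessThan[symmetric] by (simp add: iff)
  ultimately show ?thesis by (simp add: S_def)
qed

theorem proposition3p2:
  fixes M :: "'a measure" and T :: "nat \<Rightarrow> 'a \<Rightarrow> real"
    and \<alpha> lam t :: real and r :: nat
  assumes "prob_space M"
    and "lam > 0" and "0 < \<alpha>" and "\<alpha> \<le> 1"
    and "prob_space.indep_vars M (\<lambda>_. borel) T UNIV"
    and "\<And>i. distributed M lborel (T i) (\<lambda>x. ennreal (interarrival_density \<alpha> lam x))"
    and "r \<ge> 1" and "t > 0"
  shows "integrable M (\<lambda>\<omega>. falling_factorial (renewal_count T t \<omega>) r) \<and>
         factorial_moment M (renewal_count T t) r =
           fact r * lam ^ (2 * r) * t powr (2 * \<alpha> * real r)
             * mittag_leffler3 \<alpha> (2 * \<alpha> * real r + 1) (real r) (- 2 * lam * t powr \<alpha>)"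
proof -
  interpret prob_space M by fact
  note \<alpha> = assms(3,4)
  obtain q where q: "r = Suc q" using assms(7) by (cases r) auto
  have dist: "distributed M lborel (T i) (\<lambda>x. ennreal (rl_series \<alpha> 0 (relax_fps lam ^ 2) x))" for i
    using assms(6)[of i] by (simp add: interarrival_density_eq_rl_series \<alpha>)
  have [measurable]: "T i \<in> borel_measurable M" for i
    using distributed_measurable[OF dist[of i]] by simp
  have nonneg: "rl_series \<alpha> 0 (relax_fps lam ^ (2 * Suc n)) x \<ge> 0" for n x
    using rl_series_relax_fps_power_nonneg[OF \<alpha> assms(2), of "Suc (2 * n)" x] by simp
  have zero: "(relax_fps lam ^ (2 * Suc n)) $ 0 = 0" for n
    by (simp add: fps_power_zeroth)

  define S where "S n \<omega> = (\<Sum>i<n. T i \<omega>)" for n \<omega>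
  have [measurable]: "S n \<in> borel_measurable M" for n
    unfolding S_def[abs_def] by measurable
  define A where "A n = {\<omega> \<in> space M. S (Suc n) \<omega> \<le> t}" for n
  have A [measurable]: "A n \<in> sets M" for n
    unfolding A_def by measurable
  have prob_A: "prob (A n) = rl_series \<alpha> 1 (relax_fps lam ^ (2 * Suc n)) t" for n
    unfolding A_def S_def
    by (intro prob_le_rl_series \<alpha> fps_conv_radius_power_pos relax_fps_conv_radius zero nonneg
          partial_sum_distributed assms(2) assms(5) dist)
  have sums: "(\<lambda>n. real (n choose k) * prob (A n)) sums rl_series \<alpha> 1 (moment_fps lam (Suc k)) t" for k
    unfolding prob_A using assms(2) \<alpha> by (intro binomial_sum_rl_series) auto

  have "AE \<omega> in M. \<forall>i. T i \<omega> > 0"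
  proof (subst AE_all_countable, intro allI)
    fix i
    have "prob {\<omega> \<in> space M. T i \<omega> \<le> 0} = rl_series \<alpha> 1 (relax_fps lam ^ 2) 0"
      using nonneg[of 0] zero[of 0]
      by (intro prob_le_rl_series \<alpha> fps_conv_radius_power_pos relax_fps_conv_radius dist) simp_all
    hence "prob {\<omega> \<in> space M. T i \<omega> \<le> 0} = 0" by (simp add: rl_series_eq_0)
    hence "AE \<omega> in M. \<not> T i \<omega> \<le> 0"
      by (subst (asm) prob_Collect_eq_0) auto
    thus "AE \<omega> in M. T i \<omega> > 0" by (simp add: not_le)
  qed
  \<comment> \<open>The case \<open>k = 0\<close> of \<open>sums\<close> is the summability in the Borel-Cantelli lemma.\<close>
  moreover have "AE \<omega> in M. eventually (\<lambda>n. \<omega> \<in> space M - A n) sequentially"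
    using sums[of 0] by (intro borel_cantelli_AE1) (auto simp: sums_iff less_top[symmetric])
  ultimately have AE_sums: "AE \<omega> in M. (\<lambda>n. real (n choose q) * indicator (A n) \<omega>) sums real (renewal_count T t \<omega> choose r)"
    using AE_space
  proof eventually_elim
    case (elim \<omega>)
    have "eventually (\<lambda>n. (\<Sum>i<Suc n. T i \<omega>) > t) sequentially"
      using elim(2) by eventually_elim (use elim(3) in \<open>auto simp: A_def S_def not_le\<close>)
    from renewal_count_choose_sums[of T \<omega>, OF _ this, of q] elim(1,3) show ?case
      by (simp add: q A_def S_def indicator_def of_bool_def)
  qed

  let ?f = "\<lambda>n \<omega>. real (n choose q) * indicator (A n) \<omega>"
  have int_f: "integrable M (?f n)" for n
    by (intro integrable_mult_right integrable_real_indicator A) (simp add: less_top[symmetric])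
  have AE_summable: "AE \<omega> in M. summable (\<lambda>n. norm (?f n \<omega>))"
    using AE_sums by eventually_elim (simp add: sums_iff)
  have integral_f: "(\<integral>\<omega>. norm (?f n \<omega>) \<partial>M) = real (n choose q) * prob (A n)"
                   "(\<integral>\<omega>. ?f n \<omega> \<partial>M) = real (n choose q) * prob (A n)" for n
    by (simp_all add: A)
  have summable_f: "summable (\<lambda>n. \<integral>\<omega>. norm (?f n \<omega>) \<partial>M)"
    unfolding integral_f using sums[of q] by (simp add: sums_iff)
  have integral_suminf_f: "(\<integral>\<omega>. (\<Sum>n. ?f n \<omega>) \<partial>M) = rl_series \<alpha> 1 (moment_fps lam r) t"
    using integral_suminf[OF int_f AE_summable summable_f] sums[of q]
    unfolding integral_f by (simp add: sums_iff q)

  \<comment> \<open>The almost sure identity \<open>AE_sums\<close> does not give measurability of the count, as \<open>M\<close> need not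
    be complete.\<close>
  have meas [measurable]: "renewal_count T t \<in> measurable M (count_space UNIV)"
    unfolding renewal_count_def[abs_def] by measurable
  have AE_eq: "AE \<omega> in M. fact r * (\<Sum>n. ?f n \<omega>) = falling_factorial (renewal_count T t \<omega>) r"
    using AE_sums by eventually_elim (simp add: falling_factorial_eq_binomial sums_iff)
  have int: "integrable M (\<lambda>\<omega>. fact r * (\<Sum>n. ?f n \<omega>))"
    by (intro integrable_mult_right integrable_suminf[OF int_f AE_summable summable_f])
  have "integrable M (\<lambda>\<omega>. falling_factorial (renewal_count T t \<omega>) r)"
    by (rule integrable_cong_AE_imp[OF int _ AE_eq]) measurable
  moreover have "factorial_moment M (renewal_count T t) r = (\<integral>\<omega>. fact r * (\<Sum>n. ?f n \<omega>) \<partial>M)"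
    unfolding factorial_moment_def using AE_eq by (intro integral_cong_AE) (measurable, auto)
  moreover have "\<dots> = fact r * rl_series \<alpha> 1 (moment_fps lam r) t"
    using integral_suminf_f by simp
  moreover have "rl_series \<alpha> 1 (moment_fps lam r) t =
      lam ^ (2 * r) * (t powr (2 * \<alpha> * real r)
        * mittag_leffler3 \<alpha> (2 * \<alpha> * real r + 1) (real r) (- 2 * lam * t powr \<alpha>))"
  proof -
    have B: "fps_conv_radius (fps_X ^ (2 * r) * inverse ((1 - fps_const (- 2 * lam) * fps_X) ^ r) :: real fps) > 0"
      by (intro fps_conv_radius_mult_pos inverse_linear_fps_pos) simp
    show ?thesis
      unfolding moment_fps_def rl_series_cmult[OF B \<alpha>(1)] rl_series_mittag_leffler3[OF \<alpha>(1) assms(7,8)]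
      by (simp add: mult_ac)
  qed
  ultimately show ?thesis by simp
qed

end
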